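(* Let $(m,n)$ be an even-odd pair, and write $(m,n)\sim(m',n')$ if $\mathrm{diag}(m,n)=\mathrm{diag}(m',n')$. Then: \begin{enumerate} \item $\delta(m,n)\sim\gamma(m,n)$. \item $\lambda\kappa(m,n)\sim(m,n)$ for any $\kappa\in\{\gamma,\delta,\lambda\}$. \item $\gamma\delta(m,n)\sim\lambda(m,n)$. \item $\gamma\lambda(m,n)\sim\gamma(m,n)$. \item $\gamma\gamma\kappa(m,n)\sim(m,n)$ for any $\kappa\in\{\gamma,\delta,\lambda\}$. \end{enumerate}
   Context: An even-odd pair is a pair $(m,n)$ of coprime positive integers with $m>n$ and $m+n$ odd. For a coprime pair $(m,n)$ with $m>n$, define $\gamma(m,n)=(2m-n,m)$, $\delta(m,n)=(2m+n,m)$, $\lambda(m,n)=(m+2n,n)$. Juxtaposition is composition, rightmost map applied first; e.g. $\lambda\gamma(m,n)=\lambda(\gamma(m,n))=(4m-n,m)$. For positive integers $n,m$, the graph $G_{n,m,2}$ (an augmented directed grid graph on a two-holed torus) is defined as follows. Its vertices are the $4nm$ cells $(i,c)$ of a grid with $2n$ rows $0\le i<2n$ (row $0$ on top) and $2m$ columns $0\le c<2m$ (column $0$ leftmost). The bijection $u$ ("up") on cells is $u(i,c)=(i-1,c)$ if $i\ge 1$, and $u(0,c)=(2n-1,(c+m)\bmod 2m)$. The bijection $r$ ("right") on cells is $r(i,c)=(i,c+1)$ if $c<2m-1$, and $r(i,2m-1)=((i+n)\bmod 2n,0)$. The directed edges are $(\alpha,u\alpha)$ and $(\alpha,r\alpha)$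 for every cell $\alpha$. A diagonal is a set $\{\alpha,u^{-1}r\alpha,(u^{-1}r)^2\alpha,\dots\}$ for a cell $\alpha$, i.e. an orbit of the permutation $u^{-1}r$ (apply $r$ first, then $u^{-1}$) on cells. $\mathrm{diag}(n,m)$ denotes the number of diagonals of $G_{n,m,2}$ (so $\mathrm{diag}(m,n)$ is the number of diagonals of $G_{m,n,2}$). *)

theory Defs
  imports Main
begin

definition even_odd_pair :: "nat \<times> nat \<Rightarrow> bool" where
  "even_odd_pair = (\<lambda>(m, n). 0 < n \<and> n < m \<and> coprime m n \<and> odd (m + n))"

(* The three maps are only applied to pairs (m, n) with m > n, so the truncated
   subtraction in gam agrees with integer subtraction there. *)

definition gam :: "nat \<times> nat \<Rightarrow> nat \<times> nat" where
  "gam = (\<lambda>(m, n). (2 * m - n, m))"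

definition del :: "nat \<times> nat \<Rightarrow> nat \<times> nat" where
  "del = (\<lambda>(m, n). (2 * m + n, m))"

definition lam :: "nat \<times> nat \<Rightarrow> nat \<times> nat" where
  "lam = (\<lambda>(m, n). (m + 2 * n, n))"

(* A cell is a pair (row, column); row 0 is the top row.  The edges of the graph
   join each cell a to up n m a and to right n m a. *)

definition cells :: "nat \<Rightarrow> nat \<Rightarrow> (nat \<times> nat) set" where
  "cells n m = {0..<2 * n} \<times> {0..<2 * m}"

definition up :: "nat \<Rightarrow> nat \<Rightarrow> nat \<times> nat \<Rightarrow> nat \<times> nat" where
  "up n m = (\<lambda>(i, c). if i \<ge> 1 then (i - 1, c) else (2 * n - 1, (c + m) mod (2 * m)))"

definition right :: "nat \<Rightarrow> nat \<Rightarrow> nat \<times> nat \<Rightarrow> nat \<times> nat" where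
  "right n m = (\<lambda>(i, c). if c < 2 * m - 1 then (i, c + 1) else ((i + n) mod (2 * n), 0))"

definition diag_step :: "nat \<Rightarrow> nat \<Rightarrow> nat \<times> nat \<Rightarrow> nat \<times> nat" where
  "diag_step n m = inv_into (cells n m) (up n m) \<circ> right n m"

definition diagonal :: "nat \<Rightarrow> nat \<Rightarrow> nat \<times> nat \<Rightarrow> (nat \<times> nat) set" where
  "diagonal n m a = {(diag_step n m ^^ k) a | k. True}"

definition diag :: "nat \<Rightarrow> nat \<Rightarrow> nat" where
  "diag n m = card (diagonal n m ` cells n m)"

definition diag_equiv :: "nat \<times> nat \<Rightarrow> nat \<times> nat \<Rightarrow> bool" (infix \<open>\<approx>d\<close> 50) where
  "p \<approx>d q \<longleftrightarrow> diag (fst p) (snd p) = diag (fst q) (snd q)"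

(* Both maps permute the cells, so inv_into in diag_step is a genuine inverse. *)

lemma add_half_mod:
  fixes x k :: nat
  assumes "x < 2 * k"
  shows "(x + k) mod (2 * k) = (if x < k then x + k else x - k)"
proof (cases "x < k")
  case True
  then show ?thesis by simp
next
  case False
  then have "x + k = (x - k) + 2 * k" by simp
  then have "(x + k) mod (2 * k) = (x - k) mod (2 * k)" by (metis mod_add_self2)
  with False assms show ?thesis by simp
qed

lemma bij_betw_up:
  assumes "0 < n" "0 < m"
  shows "bij_betw (up n m) (cells n m) (cells n m)"
proof -
  have "inj_on (up n m) (cells n m)"
    using assms
    by (auto simp: inj_on_def up_def cells_def add_half_mod split: if_splits)
  moreover have "up n m ` cells n m \<subseteq> cells n m"
    using assms by (auto simp: up_def cells_def split: if_splits)
  ultimately show ?thesis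
    by (simp add: bij_betw_def endo_inj_surj cells_def)
qed

lemma bij_betw_right:
  assumes "0 < n" "0 < m"
  shows "bij_betw (right n m) (cells n m) (cells n m)"
proof -
  have "inj_on (right n m) (cells n m)"
    using assms
    by (auto simp: inj_on_def right_def cells_def add_half_mod split: if_splits)
  moreover have "right n m ` cells n m \<subseteq> cells n m"
    using assms by (auto simp: right_def cells_def split: if_splits)
  ultimately show ?thesis
    by (simp add: bij_betw_def endo_inj_surj cells_def)
qed

end

theory Submission
  imports Defs
begin

text \<open>
  Cutting the grid into its four \<open>n \<times> m\<close> blocks turns the diagonals of \<open>G\<^bsub>n,m,2\<^esub>\<close> into the
  closed leaves of a surface glued from four squares according to two permutations \<open>\<sigma>\<close> (right)
  and \<open>\<tau>\<close> (down) of four letters. A transversal meets these leaves in the cycles of a skew product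
  over a rotation: a point \<open>t < a + b\<close> moves to \<open>t + b\<close> modulo \<open>a + b\<close>, and the letter is
  changed by \<open>\<tau>\<close> or \<open>\<sigma>\<close>, according to whether \<open>t < a\<close>. Inducing on a subinterval is one step of the
  Euclidean algorithm: it replaces \<open>(\<sigma>, \<tau>; a, b)\<close> by \<open>(\<sigma>, \<sigma>\<tau>; a, b - a)\<close> without changing
  the number of cycles. So both sides of each claimed equality reduce to the same pair of lengths,
  and there the two pairs of permutations turn out to be simultaneously conjugate.
\<close>

section \<open>Counting orbits\<close>

definition orb :: "('x \<Rightarrow> 'x) \<Rightarrow> 'x \<Rightarrow> 'x set" where
  "orb f x = {(f ^^ k) x | k. True}"

definition norb :: "('x \<Rightarrow> 'x) \<Rightarrow> 'x set \<Rightarrow> nat" where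
  "norb f S = card (orb f ` S)"

lemma orb_self: "x \<in> orb f x"
  unfolding orb_def by (rule CollectI, rule exI[of _ 0]) simp

lemma orb_funpow: "(f ^^ k) x \<in> orb f x"
  unfolding orb_def by blast

lemma orb_step: "f x \<in> orb f x"
  using orb_funpow[where k = 1] by simp

lemma orb_trans:
  assumes "y \<in> orb f x" "z \<in> orb f y"
  shows "z \<in> orb f x"
proof -
  obtain i j where "y = (f ^^ i) x" "z = (f ^^ j) y"
    using assms unfolding orb_def by blast
  then have "z = (f ^^ (j + i)) x" by (simp add: funpow_add)
  then show ?thesis by (simp add: orb_funpow)
qed

lemma funpow_mem:
  assumes "bij_betw f S S" "x \<in> S"
  shows "(f ^^ k) x \<in> S"
  using assms by (induction k) (auto simp: bij_betw_def)

lemma funpow_funpow: "(f ^^ i) ((f ^^ j) x) = (f ^^ (i + j)) x"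
  by (simp add: funpow_add)

text \<open>\<open>orb\<close> uses forward iterates only, but a point of a finite set returns to
  itself under a permutation, so these forward orbits are equivalence classes.\<close>

lemma orb_sym:
  assumes "finite S" "bij_betw f S S" "x \<in> S" "y \<in> orb f x"
  shows "x \<in> orb f y"
proof -
  obtain i where i: "y = (f ^^ i) x" using assms(4) unfolding orb_def by blast
  have "finite (range (\<lambda>k. (f ^^ k) x))"
    using funpow_mem[OF assms(2,3)] by (intro finite_subset[OF _ assms(1)]) auto
  then have "\<not> inj (\<lambda>k. (f ^^ k) x)"
    using finite_imageD infinite_UNIV_nat by blast
  then obtain k l where "k < l" "(f ^^ k) x = (f ^^ l) x"
    unfolding inj_def by (metis linorder_neqE_nat)
  then have "(f ^^ k) ((f ^^ (l - k)) x) = (f ^^ k) x"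
    by (simp add: funpow_funpow)
  moreover have "inj_on (f ^^ k) S"
    using bij_betw_funpow[OF assms(2)] by (auto simp: bij_betw_def)
  ultimately have period: "(f ^^ (l - k)) x = x"
    using funpow_mem[OF assms(2,3)] assms(3) by (meson inj_onD)
  have "(f ^^ (j * (l - k))) x = x" for j
    by (induction j) (simp_all add: funpow_add period)
  \<comment> \<open>The period \<open>l - k\<close> is at least 1, so \<open>i\<close> periods take
    at least \<open>i\<close> steps and the truncated subtraction is genuine.\<close>
  moreover have "i * (l - k) - i + i = i * (l - k)"
    using \<open>k < l\<close> by (cases "l - k") simp_all
  ultimately have "(f ^^ (i * (l - k) - i)) y = x"
    unfolding i funpow_funpow by simp
  then show ?thesis by (metis orb_funpow)
qed

lemma orb_eq_iff:
  assumes "finite S" "bij_betw f S S" "x \<in> S"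
  shows "orb f x = orb f y \<longleftrightarrow> y \<in> orb f x"
proof
  assume "y \<in> orb f x"
  moreover from this have "x \<in> orb f y" using orb_sym[OF assms] by blast
  ultimately show "orb f x = orb f y" using orb_trans[of _ f] by blast
next
  assume "orb f x = orb f y"
  then show "y \<in> orb f x" using orb_self[of y f] by simp
qed

text \<open>The map \<phi> induces a bijection of orbits: \<open>forward\<close> makes it well
  defined, \<open>backward\<close> injective and \<open>meets\<close> surjective. It need not
  commute with the two permutations.\<close>

lemma norb_eqI:
  assumes S: "finite S" "bij_betw f S S" and T: "finite T" "bij_betw g T T"
    and mem: "\<And>x. x \<in> T \<Longrightarrow> \<phi> x \<in> S"
    and forward: "\<And>x. x \<in> T \<Longrightarrow> \<phi> (g x) \<in> orb f (\<phi> x)"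
    and backward: "\<And>x y. x \<in> T \<Longrightarrow> y \<in> T \<Longrightarrow> \<phi> y \<in> orb f (\<phi> x) \<Longrightarrow> y \<in> orb g x"
    and meets: "\<And>x. x \<in> S \<Longrightarrow> \<exists>y\<in>T. \<phi> y \<in> orb f x"
  shows "norb f S = norb g T"
proof -
  have fw: "\<phi> ((g ^^ k) x) \<in> orb f (\<phi> x)" if "x \<in> T" for x k
  proof (induction k)
    case (Suc k)
    then show ?case
      using orb_trans forward funpow_mem[OF T(2) that] by fastforce
  qed (simp add: orb_self)
  have eq: "orb f (\<phi> x) = orb f (\<phi> y) \<longleftrightarrow> orb g x = orb g y" if "x \<in> T" "y \<in> T" for x y
  proof -
    have "y \<in> orb g x \<longleftrightarrow> \<phi> y \<in> orb f (\<phi> x)"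
      using fw[OF that(1)] backward[OF that] unfolding orb_def[of g] by blast
    then show ?thesis
      using orb_eq_iff[OF S mem[OF that(1)]] orb_eq_iff[OF T that(1)] by blast
  qed
  have "orb f ` S = (\<lambda>y. orb f (\<phi> y)) ` T"
  proof (intro equalityI subsetI)
    fix A assume "A \<in> orb f ` S"
    then obtain x where x: "x \<in> S" "A = orb f x" by blast
    then obtain y where "y \<in> T" "\<phi> y \<in> orb f x" using meets by blast
    then show "A \<in> (\<lambda>y. orb f (\<phi> y)) ` T"
      using x orb_eq_iff[OF S x(1)] by blast
  qed (use mem in blast)
  \<comment> \<open>By \<open>eq\<close>, the chosen representative does not affect the resulting
    orbit.\<close>
  moreover have "bij_betw (\<lambda>A. orb f (\<phi> (SOME x. x \<in> T \<and> orb g x = A)))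
      (orb g ` T) ((\<lambda>y. orb f (\<phi> y)) ` T)"
  proof -
    have pick: "orb f (\<phi> (SOME x. x \<in> T \<and> orb g x = orb g y)) = orb f (\<phi> y)" if "y \<in> T" for y
    proof -
      have "(SOME x. x \<in> T \<and> orb g x = orb g y) \<in> T \<and>
          orb g (SOME x. x \<in> T \<and> orb g x = orb g y) = orb g y"
        by (rule someI[of _ y]) (simp add: that)
      then show ?thesis using eq that by blast
    qed
    show ?thesis
      unfolding bij_betw_def
    proof
      show "inj_on (\<lambda>A. orb f (\<phi> (SOME x. x \<in> T \<and> orb g x = A))) (orb g ` T)"
        using pick eq by (auto intro!: inj_onI)
      show "(\<lambda>A. orb f (\<phi> (SOME x. x \<in> T \<and> orb g x = A))) ` orb g ` T
          = (\<lambda>y. orb f (\<phi> y)) ` T"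
        unfolding image_image by (rule image_cong[OF refl]) (rule pick)
    qed
  qed
  ultimately show ?thesis
    unfolding norb_def by (simp add: bij_betw_same_card)
qed

lemma norb_conj:
  assumes S: "finite S" "bij_betw f S S" and T: "bij_betw g T T"
    and \<phi>: "bij_betw \<phi> T S" and comm: "\<And>x. x \<in> T \<Longrightarrow> \<phi> (g x) = f (\<phi> x)"
  shows "norb f S = norb g T"
proof -
  have pow: "\<phi> ((g ^^ k) x) = (f ^^ k) (\<phi> x)" if "x \<in> T" for x k
    by (induction k) (simp_all add: comm funpow_mem[OF T that])
  show ?thesis
  proof (rule norb_eqI[OF S _ T, of \<phi>])
    show "finite T" using S(1) \<phi> bij_betw_finite by blast
  next
    fix x assume "x \<in> T"
    then show "\<phi> x \<in> S" using \<phi> by (auto simp: bij_betw_def)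
    show "\<phi> (g x) \<in> orb f (\<phi> x)" using comm[OF \<open>x \<in> T\<close>] by (simp add: orb_step)
  next
    fix x y assume xy: "x \<in> T" "y \<in> T" "\<phi> y \<in> orb f (\<phi> x)"
    then obtain k where "\<phi> y = \<phi> ((g ^^ k) x)" unfolding orb_def using pow by auto
    then have "y = (g ^^ k) x"
      using \<phi> xy funpow_mem[OF T] unfolding bij_betw_def by (meson inj_onD)
    then show "y \<in> orb g x" by (simp add: orb_funpow)
  next
    fix x assume "x \<in> S"
    then obtain y where "y \<in> T" "\<phi> y = x" using \<phi> unfolding bij_betw_def by blast
    then show "\<exists>y\<in>T. \<phi> y \<in> orb f x" using orb_self by metis
  qed
qed

text \<open>Here \<open>g\<close> is the first return map to \<open>A\<close>. Every orbit meets
  \<open>A\<close>, and a return takes at most two steps.\<close>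

lemma norb_induced:
  assumes S: "finite S" "bij_betw f S S" and A: "A \<subseteq> S" "bij_betw g A A"
    and g: "\<And>x. x \<in> A \<Longrightarrow> g x = (if f x \<in> A then f x else f (f x))"
    and return: "\<And>x. x \<in> S \<Longrightarrow> x \<notin> A \<Longrightarrow> f x \<in> A"
  shows "norb f S = norb g A"
proof (rule norb_eqI[OF S _ A(2), of "\<lambda>x. x"])
  show "finite A" using S(1) A(1) finite_subset by blast
next
  fix x assume "x \<in> A"
  then show "x \<in> S" using A(1) by blast
  show "g x \<in> orb f x"
    using g[OF \<open>x \<in> A\<close>] by (simp add: orb_step orb_trans[OF orb_step orb_step])
next
  fix x y assume "x \<in> A" "y \<in> A" "y \<in> orb f x"
  \<comment> \<open>Strong induction peels off one \<open>g\<close> step, worth one or two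
    \<open>f\<close> steps. The walk cannot stop halfway through a double step, since that point is
    outside \<open>A\<close>.\<close>
  have "(f ^^ k) x \<in> A \<Longrightarrow> (f ^^ k) x \<in> orb g x" if "x \<in> A" for k x
    using that
  proof (induction k arbitrary: x rule: less_induct)
    case (less k)
    have gx: "g x \<in> A" using A(2) less.prems(2) by (auto simp: bij_betw_def)
    show ?case
    proof (cases k)
      case 0
      then show ?thesis by (simp add: orb_self)
    next
      case (Suc k')
      then have k': "(f ^^ k) x = (f ^^ k') (f x)" by (simp add: funpow_swap1)
      show ?thesis
      proof (cases "f x \<in> A")
        case True
        then have "(f ^^ k') (g x) \<in> orb g (g x)"
          using less.IH[of k' "g x"] less.prems gx g k' Suc by simp
        then show ?thesis
          using orb_trans[OF orb_step] k' g[OF less.prems(2)] True by fastforce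
      next
        case False
        then obtain k'' where k'': "k' = Suc k''"
          using k' less.prems(1) by (cases k') auto
        have eq: "(f ^^ k) x = (f ^^ k'') (g x)"
          using k' k'' g[OF less.prems(2)] False by (simp add: funpow_swap1)
        then have "(f ^^ k'') (g x) \<in> orb g (g x)"
          using less.IH[of k'' "g x"] less.prems gx k'' Suc by simp
        then show ?thesis using orb_trans[OF orb_step] eq by fastforce
      qed
    qed
  qed
  then show "y \<in> orb g x"
    using \<open>x \<in> A\<close> \<open>y \<in> A\<close> \<open>y \<in> orb f x\<close> unfolding orb_def[of f] by blast
next
  fix x assume "x \<in> S"
  then show "\<exists>y\<in>A. y \<in> orb f x"
    using return[of x] orb_self[of x f] orb_step[of f x] by blast
qed

section \<open>Skew products over rotations\<close>

definition skew :: "('q \<Rightarrow> 'q) \<Rightarrow> ('q \<Rightarrow> 'q) \<Rightarrow> nat \<Rightarrow> nat \<Rightarrow> 'q \<times> nat \<Rightarrow> 'q \<times> nat" where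
  "skew \<sigma> \<tau> a b = (\<lambda>(q, t). if t < a then (\<tau> q, t + b) else (\<sigma> q, t - a))"

definition cyc :: "('q \<Rightarrow> 'q) \<Rightarrow> ('q \<Rightarrow> 'q) \<Rightarrow> nat \<Rightarrow> nat \<Rightarrow> nat" where
  "cyc \<sigma> \<tau> a b = norb (skew \<sigma> \<tau> a b) (UNIV \<times> {..<a + b})"

section \<open>Invariance of the cycle count under induction, reflection and relabelling\<close>

lemma bij_betw_skew:
  fixes \<sigma> \<tau> :: "'q::finite \<Rightarrow> 'q"
  assumes "bij \<sigma>" "bij \<tau>"
  shows "bij_betw (skew \<sigma> \<tau> a b) (UNIV \<times> {..<a + b}) (UNIV \<times> {..<a + b})"
proof -
  have "inj_on (skew \<sigma> \<tau> a b) (UNIV \<times> {..<a + b})"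
    by (rule inj_onI)
      (auto simp: skew_def inj_eq[OF bij_is_inj[OF assms(1)]] inj_eq[OF bij_is_inj[OF assms(2)]]
        split: if_splits)
  moreover have "skew \<sigma> \<tau> a b ` (UNIV \<times> {..<a + b}) \<subseteq> UNIV \<times> {..<a + b}"
    by (auto simp: skew_def split: if_splits)
  ultimately show ?thesis by (simp add: bij_betw_def endo_inj_surj)
qed

text \<open>First return to \<open>t < a + b\<close>: a point with \<open>t < a\<close> jumps out
  and comes back at \<open>t + b\<close>, collecting \<tau> and then \<sigma>; all others stay
  inside.\<close>

lemma cyc_add:
  fixes \<sigma> \<tau> :: "'q::finite \<Rightarrow> 'q"
  assumes "bij \<sigma>" "bij \<tau>"
  shows "cyc \<sigma> \<tau> a (a + b) = cyc \<sigma> (\<sigma> \<circ> \<tau>) a b"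
  unfolding cyc_def
proof (rule norb_induced)
  show "bij_betw (skew \<sigma> \<tau> a (a + b)) (UNIV \<times> {..<a + (a + b)}) (UNIV \<times> {..<a + (a + b)})"
    "bij_betw (skew \<sigma> (\<sigma> \<circ> \<tau>) a b) (UNIV \<times> {..<a + b}) (UNIV \<times> {..<a + b})"
    using assms by (auto intro!: bij_betw_skew bij_comp)
qed (auto simp: skew_def split: if_splits)

text \<open>Reflecting the interval exchanges its two pieces and reverses the rotation.\<close>

lemma cyc_swap:
  fixes \<sigma> \<tau> :: "'q::finite \<Rightarrow> 'q"
  assumes "bij \<sigma>" "bij \<tau>"
  shows "cyc \<sigma> \<tau> a b = cyc \<tau> \<sigma> b a"
  unfolding cyc_def
proof (rule norb_conj[where \<phi> = "\<lambda>(q, t). (q, a + b - 1 - t)"])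
  show "bij_betw (skew \<sigma> \<tau> a b) (UNIV \<times> {..<a + b}) (UNIV \<times> {..<a + b})"
    "bij_betw (skew \<tau> \<sigma> b a) (UNIV \<times> {..<b + a}) (UNIV \<times> {..<b + a})"
    using assms by (auto intro!: bij_betw_skew)
  show "bij_betw (\<lambda>(q, t). (q, a + b - 1 - t)) (UNIV \<times> {..<b + a}) (UNIV \<times> {..<a + b})"
    by (rule bij_betw_byWitness[where f' = "\<lambda>(q, t). (q, a + b - 1 - t)"]) auto
qed (auto simp: skew_def)

text \<open>Mirror image of \<open>cyc_add\<close>: the Euclidean step that shortens the first
  length.\<close>

lemma cyc_add':
  fixes \<sigma> \<tau> :: "'q::finite \<Rightarrow> 'q"
  assumes "bij \<sigma>" "bij \<tau>"
  shows "cyc \<sigma> \<tau> (b + a) b = cyc (\<tau> \<circ> \<sigma>) \<tau> a b"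
proof -
  have "cyc \<sigma> \<tau> (b + a) b = cyc \<tau> \<sigma> b (b + a)"
    by (rule cyc_swap[OF assms])
  also have "\<dots> = cyc \<tau> (\<tau> \<circ> \<sigma>) b a"
    by (rule cyc_add[OF assms(2,1)])
  also have "\<dots> = cyc (\<tau> \<circ> \<sigma>) \<tau> a b"
    by (rule cyc_swap) (simp_all add: assms bij_comp)
  finally show ?thesis .
qed

lemma cyc_conj:
  fixes \<sigma> \<tau> \<sigma>' \<tau>' :: "'q::finite \<Rightarrow> 'q"
  assumes "bij \<sigma>" "bij \<tau>" "bij \<sigma>'" "bij \<tau>'" "bij \<pi>"
    and "\<pi> \<circ> \<sigma> = \<sigma>' \<circ> \<pi>" "\<pi> \<circ> \<tau> = \<tau>' \<circ> \<pi>"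
  shows "cyc \<sigma> \<tau> a b = cyc \<sigma>' \<tau>' a b"
  unfolding cyc_def
proof (rule norb_conj[where \<phi> = "map_prod \<pi> id", symmetric])
  show "bij_betw (skew \<sigma> \<tau> a b) (UNIV \<times> {..<a + b}) (UNIV \<times> {..<a + b})"
    "bij_betw (skew \<sigma>' \<tau>' a b) (UNIV \<times> {..<a + b}) (UNIV \<times> {..<a + b})"
    using assms by (auto intro!: bij_betw_skew)
  show "bij_betw (map_prod \<pi> id) (UNIV \<times> {..<a + b}) (UNIV \<times> {..<a + b})"
    using assms(5) by (intro bij_betw_map_prod) auto
qed (use assms(6,7) in \<open>auto simp: skew_def fun_eq_iff\<close>)

section \<open>Diagonals as cycles of a skew product\<close>

text \<open>
  The four blocks of the grid are indexed by pairs of truth values: whether the block is in the lower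
  half, and whether it is in the right half.
\<close>

fun sr :: "bool \<times> bool \<Rightarrow> bool \<times> bool" where
  "sr (i, j) = (i \<noteq> j, \<not> j)"

text \<open>In \<open>sr\<close> and \<open>sd\<close> the exclusive or records the half shift,
  which occurs only on leaving the grid through its border. Both maps are four-cycles.\<close>

fun sd :: "bool \<times> bool \<Rightarrow> bool \<times> bool" where
  "sd (i, j) = (\<not> i, i \<noteq> j)"

lemma bij_bool_pairI:
  fixes f :: "bool \<times> bool \<Rightarrow> bool \<times> bool"
  assumes "inj f"
  shows "bij f"
  using assms by (simp add: bij_def finite_UNIV_inj_surj)

lemma bij_sr [simp]: "bij sr"
  by (rule bij_bool_pairI) (auto simp: inj_def)

lemma bij_sd [simp]: "bij sd"
  by (rule bij_bool_pairI) (auto simp: inj_def)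

definition down :: "nat \<Rightarrow> nat \<Rightarrow> nat \<times> nat \<Rightarrow> nat \<times> nat" where
  "down n m = (\<lambda>(i, c). if i + 1 < 2 * n then (i + 1, c) else (0, (c + m) mod (2 * m)))"

text \<open>\<open>down\<close> is the inverse of \<open>up\<close> on the cells: a shift by half of
  the columns is its own inverse.\<close>

lemma diag_step_eq:
  assumes "0 < n" "0 < m" "x \<in> cells n m"
  shows "diag_step n m x = down n m (right n m x)"
proof -
  have r: "right n m x \<in> cells n m"
    using bij_betw_right[OF assms(1,2)] assms(3) by (auto simp: bij_betw_def)
  have "up n m (down n m y) = y \<and> down n m y \<in> cells n m" if "y \<in> cells n m" for y
    using that assms(1,2)
    by (auto simp: up_def down_def cells_def add_half_mod split: if_splits)
  then show ?thesis
    unfolding diag_step_def comp_apply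
    using bij_betw_up[OF assms(1,2)] r by (metis bij_betw_def inv_into_f_f)
qed

lemma bij_betw_diag_step:
  assumes "0 < n" "0 < m"
  shows "bij_betw (diag_step n m) (cells n m) (cells n m)"
  unfolding diag_step_def
  using bij_betw_trans[OF bij_betw_right[OF assms] bij_betw_inv_into[OF bij_betw_up[OF assms]]] .

text \<open>All wraps change the column by a multiple of \<open>m\<close>, so the residue counts
  steps and fixes the times at which a diagonal can meet the transversal.\<close>

lemma snd_diag_step_mod:
  assumes "0 < n" "0 < m" "x \<in> cells n m"
  shows "snd (diag_step n m x) mod m = Suc (snd x) mod m"
proof -
  have *: "(d + m) mod (2 * m) mod m = d mod m" for d
    by (simp add: mod_mod_cancel)
  have r: "snd (right n m x) mod m = Suc (snd x) mod m"
  proof (cases "snd x < 2 * m - 1")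
    case False
    then have "Suc (snd x) = 2 * m" using assms by (auto simp: cells_def)
    then show ?thesis using False by (cases x) (simp add: right_def)
  qed (cases x; simp add: right_def)
  show ?thesis
    unfolding diag_step_eq[OF assms] r[symmetric]
    by (auto simp: down_def * split: prod.splits)
qed

lemma snd_diag_step_funpow_mod:
  assumes "0 < n" "0 < m" "x \<in> cells n m"
  shows "snd ((diag_step n m ^^ k) x) mod m = (snd x + k) mod m"
proof (induction k)
  case (Suc k)
  have "snd ((diag_step n m ^^ Suc k) x) mod m = Suc (snd ((diag_step n m ^^ k) x)) mod m"
    using snd_diag_step_mod[OF assms(1,2) funpow_mem[OF bij_betw_diag_step assms(3)]] assms(1,2)
    by simp
  also have "\<dots> = (snd x + Suc k) mod m"
    using Suc by (metis add_Suc_right mod_Suc_eq)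
  finally show ?case .
qed simp

section \<open>First return of the diagonals to a transversal\<close>

text \<open>
  The transversal consists of the last column of each of the two halves. The coordinate \<open>t\<close> counts
  the rows upwards from the bottom of the block.
\<close>

definition sect :: "nat \<Rightarrow> nat \<Rightarrow> (bool \<times> bool) \<times> nat \<Rightarrow> nat \<times> nat" where
  "sect n m = (\<lambda>((i, j), t). (of_bool i * n + (n - 1 - t), of_bool j * m + (m - 1)))"

text \<open>The first step enters block \<open>(i, j)\<close>, and then the walk descends through
  its columns. The unwrapped row \<open>y\<close> stays below \<open>3 * n\<close> because
  \<open>m \<le> n\<close>, so the bottom border is crossed at most once; the crossing flips
  \<open>j\<close>.\<close>

lemma diag_step_funpow_sect:
  assumes "0 < n" "0 < m" "m \<le> n" "t < n" "sr q = (i, j)" "k < m"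
  defines "y \<equiv> of_bool i * n + (n - 1 - t) + Suc k"
  shows "(diag_step n m ^^ Suc k) (sect n m (q, t)) =
    (if y < 2 * n then (y, of_bool j * m + k) else (y - 2 * n, of_bool (\<not> j) * m + k))"
  using assms(6) unfolding y_def
proof (induction k)
  case 0
  obtain i' j' where q: "q = (i', j')" by fastforce
  have "sect n m (q, t) \<in> cells n m"
    using assms by (auto simp: sect_def cells_def q)
  then have step: "diag_step n m (sect n m (q, t)) = down n m (right n m (sect n m (q, t)))"
    using diag_step_eq assms by blast
  define w where "w = n - 1 - t"
  have "w < n" using assms(4) unfolding w_def by simp
  then show ?case
    using step assms(2,5) unfolding sect_def w_def[symmetric] prod.case q
    by (cases i'; cases j') (auto simp: down_def right_def q add_half_mod)
next
  case (Suc k)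
  define z where "z = of_bool i * n + (n - 1 - t) + Suc k"
  define x where "x = (if z < 2 * n then (z, of_bool j * m + k) else (z - 2 * n, of_bool (\<not> j) * m + k))"
  have z: "z < 3 * n" unfolding z_def using assms(1-4) Suc.prems by (cases i) auto
  then have z': "Suc (z - 2 * n) < 2 * n" using assms(1) by linarith
  have x: "(diag_step n m ^^ Suc k) (sect n m (q, t)) = x"
    using Suc unfolding x_def z_def by simp
  have "x \<in> cells n m"
    using z Suc.prems by (auto simp: x_def cells_def)
  then have "(diag_step n m ^^ Suc (Suc k)) (sect n m (q, t)) = down n m (right n m x)"
    using diag_step_eq[of n m x] assms(1,2) x by simp
  also have "\<dots> = (if Suc z < 2 * n then (Suc z, of_bool j * m + Suc k)
      else (Suc z - 2 * n, of_bool (\<not> j) * m + Suc k))"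
    using z z' Suc.prems add_half_mod[of "m + Suc k" m]
    by (auto simp: x_def right_def down_def add_half_mod)
  finally show ?case unfolding z_def by simp
qed

text \<open>In \<open>m\<close> steps the walk descends \<open>m\<close> rows. It leaves the block
  through its bottom exactly when \<open>t < m\<close>, which adds the letter change
  \<open>sd\<close>.\<close>

lemma diag_step_return:
  assumes "0 < n" "0 < m" "m \<le> n" "x \<in> UNIV \<times> {..<n}"
  shows "(diag_step n m ^^ m) (sect n m x) = sect n m (skew sr (sd \<circ> sr) m (n - m) x)"
proof -
  obtain q t i j where x: "x = (q, t)" and q: "sr q = (i, j)" by (metis surj_pair)
  have t: "t < n" using assms(4) x by simp
  obtain m' where m': "m = Suc m'" using assms(2) by (cases m) auto
  show ?thesis
    using diag_step_funpow_sect[OF assms(1-3) t q, of m'] assms(1-3) t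
    unfolding x m' by (auto simp: skew_def sect_def q)
qed

lemma diag_eq_cyc_return:
  assumes "0 < m" "m \<le> n"
  shows "diag n m = cyc sr (sd \<circ> sr) m (n - m)"
proof -
  let ?f = "diag_step n m"
  define g where "g = skew sr (sd \<circ> sr) m (n - m)"
  let ?T = "UNIV \<times> {..<n} :: ((bool \<times> bool) \<times> nat) set"
  have n: "0 < n" using assms by simp
  have f: "bij_betw ?f (cells n m) (cells n m)"
    by (rule bij_betw_diag_step[OF n assms(1)])
  have bij_g: "bij_betw g ?T ?T"
    using bij_betw_skew[OF bij_sr bij_comp[OF bij_sr bij_sd], of m "n - m"] assms unfolding g_def by simp
  have mem: "sect n m x \<in> cells n m" if "x \<in> ?T" for x
    using that assms by (auto simp: sect_def cells_def)
  have col: "Suc (snd (sect n m x)) mod m = 0" for x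
    using assms(1) by (cases x) (auto simp: sect_def)
  have pow: "(?f ^^ (m * k)) (sect n m x) = sect n m ((g ^^ k) x)" if "x \<in> ?T" for x k
  proof (induction k)
    case (Suc k)
    then show ?case
      using diag_step_return[OF n assms, folded g_def, OF funpow_mem[OF bij_g that]]
      by (simp add: funpow_add)
  qed simp
  have inj: "inj_on (sect n m) ?T"
  proof (rule inj_onI)
    fix x y assume *: "x \<in> ?T" "y \<in> ?T" "sect n m x = sect n m y"
    obtain i j t i' j' t' where "x = ((i, j), t)" "y = ((i', j'), t')" by (metis surj_pair)
    then show "x = y"
      using * assms(1) by (cases i; cases i'; cases j; cases j') (auto simp: sect_def)
  qed
  have "norb ?f (cells n m) = norb g ?T"
  proof (rule norb_eqI[OF _ f _ bij_g, of "sect n m"])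
    show "finite (cells n m)" "finite ?T" by (simp_all add: cells_def)
  next
    fix x assume "x \<in> ?T"
    then show "sect n m x \<in> cells n m" by (rule mem)
    show "sect n m (g x) \<in> orb ?f (sect n m x)"
      using diag_step_return[OF n assms, folded g_def, OF \<open>x \<in> ?T\<close>] orb_funpow by metis
  next
    fix x y assume xy: "x \<in> ?T" "y \<in> ?T" "sect n m y \<in> orb ?f (sect n m x)"
    then obtain k where k: "sect n m y = (?f ^^ k) (sect n m x)" unfolding orb_def by blast
    have "(Suc (snd (sect n m x)) + k) mod m = Suc (snd (sect n m y)) mod m"
      unfolding k
      using snd_diag_step_funpow_mod[OF n assms(1) mem[OF xy(1)], of k]
      by (metis add_Suc mod_Suc_eq)
    \<comment> \<open>Both points lie in columns of residue \<open>m - 1\<close>, so the diagonal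
      runs between them in whole returns.\<close>
    then have "m dvd k"
      using col by (metis add_0 mod_0_imp_dvd mod_add_left_eq)
    then obtain l where "k = m * l" by blast
    then have "sect n m y = sect n m ((g ^^ l) x)" using k pow[OF xy(1)] by simp
    then have "y = (g ^^ l) x"
      using inj xy funpow_mem[OF bij_g] by (meson inj_onD)
    then show "y \<in> orb g x" by (simp add: orb_funpow)
  next
    fix x assume x: "x \<in> cells n m"
    \<comment> \<open>The number of steps until the column residue becomes
      \<open>m - 1\<close>.\<close>
    define k where "k = m - 1 - snd x mod m"
    obtain i c where ic: "(?f ^^ k) x = (i, c)" by fastforce
    have mem': "(i, c) \<in> cells n m" using funpow_mem[OF f x, of k] ic by simp
    have "c mod m = (snd x mod m + k) mod m"
      using snd_diag_step_funpow_mod[OF n assms(1) x, of k] ic by (simp add: mod_add_left_eq)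
    also have "snd x mod m + k = m - 1"
      unfolding k_def using assms(1) mod_less_divisor[of m "snd x"] by linarith
    finally have c: "c mod m = m - 1" using assms(1) by simp
    have "c div m < 2" using mem' by (simp add: cells_def less_mult_imp_div_less)
    then have c': "c = of_bool (c div m = 1) * m + (m - 1)"
      using div_mult_mod_eq[of c m] unfolding c by (cases "c div m = 0") (auto simp: less_2_cases_iff)
    define y where "y = ((n \<le> i, c div m = 1), if n \<le> i then 2 * n - 1 - i else n - 1 - i)"
    have "y \<in> ?T" using n by (auto simp: y_def)
    moreover have "sect n m y = (i, c)"
      using mem' c' by (auto simp: y_def sect_def cells_def)
    ultimately show "\<exists>y\<in>?T. sect n m y \<in> orb ?f x"
      using ic orb_funpow by metis
  qed
  then show ?thesis
    using assms unfolding g_def diag_def cyc_def norb_def diagonal_def orb_def[abs_def] by simp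
qed

text \<open>Conjugation by \<open>sr\<close> turns \<open>sd \<circ> sr\<close> into
  \<open>sr \<circ> sd\<close>; then \<open>cyc_add\<close>, read backwards, restores the full
  lengths, smaller one first.\<close>

lemma diag_eq_cyc:
  assumes "0 < m" "m \<le> n"
  shows "diag n m = cyc sr sd m n"
proof -
  have "diag n m = cyc sr (sd \<circ> sr) m (n - m)"
    by (rule diag_eq_cyc_return[OF assms])
  also have "\<dots> = cyc sr (sr \<circ> sd) m (n - m)"
    by (rule cyc_conj[where \<pi> = sr]) (simp_all add: bij_sr bij_sd bij_comp comp_assoc)
  also have "\<dots> = cyc sr sd m n"
    using cyc_add[OF bij_sr bij_sd, of m "n - m"] assms(2) by simp
  finally show ?thesis .
qed

section \<open>The relations\<close>

lemma bij_block_comp [simp]: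
  fixes f g :: "bool \<times> bool \<Rightarrow> bool \<times> bool"
  shows "bij f \<Longrightarrow> bij g \<Longrightarrow> bij (f \<circ> g)"
  by (rule bij_comp)

text \<open>Reduces simultaneous conjugacy on the four blocks to a finite pointwise check.\<close>

lemma cyc_block_conj:
  fixes \<sigma> \<tau> \<sigma>' \<tau>' \<pi> :: "bool \<times> bool \<Rightarrow> bool \<times> bool"
  assumes "bij \<sigma>" "bij \<tau>" "bij \<sigma>'" "bij \<tau>'" "inj \<pi>"
    and "\<And>i j. \<pi> (\<sigma> (i, j)) = \<sigma>' (\<pi> (i, j))" "\<And>i j. \<pi> (\<tau> (i, j)) = \<tau>' (\<pi> (i, j))"
  shows "cyc \<sigma> \<tau> a b = cyc \<sigma>' \<tau>' a b"
  by (rule cyc_conj[OF assms(1-4) bij_bool_pairI[OF assms(5)]]) (auto simp: fun_eq_iff assms(6,7))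

text \<open>Transposing the array of blocks interchanges right and down.\<close>

lemma cyc_sr_sd_swap: "cyc sr sd a b = cyc sd sr a b"
  by (rule cyc_block_conj[where \<pi> = "\<lambda>(i, j). (j, i)"]) (auto simp: inj_def)

lemma sr_pow4: "sr \<circ> (sr \<circ> (sr \<circ> (sr \<circ> sd))) = sd"
  by (auto simp: fun_eq_iff)

lemma cyc_sr_add2: "cyc sr sd a (b + 2 * a) = cyc sr (sr \<circ> (sr \<circ> sd)) a b"
proof -
  have "b + 2 * a = a + (a + b)" by simp
  then show ?thesis by (simp only: cyc_add bij_sr bij_sd bij_block_comp)
qed

lemma cyc_sr_add4: "cyc sr sd a (b + 4 * a) = cyc sr sd a b"
proof -
  have "b + 4 * a = a + (a + b) + 2 * a" by simp
  then show ?thesis by (simp only: cyc_sr_add2 cyc_add bij_sr bij_sd bij_block_comp sr_pow4)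
qed

section \<open>Cycle counts for the composed maps\<close>

text \<open>Here \<open>(m, n) = (n + d, n)\<close>, so that \<open>\<gamma>(m, n) = (m + d, m)\<close>.\<close>

lemma cyc_gam:
  assumes "a = n + d" "b = n + 2 * d"
  shows "cyc sr sd a b = cyc (sr \<circ> sd \<circ> sr) (sr \<circ> sd) n d"
proof -
  \<comment> \<open>Two Euclidean steps, from \<open>(n + d, n + 2 * d)\<close> to
    \<open>(n + d, d)\<close> to \<open>(n, d)\<close>.\<close>
  have "b = n + d + d" using assms(2) by simp
  then show ?thesis
    unfolding assms(1)
    by (simp only: cyc_add cyc_add' add.commute[of n] bij_sr bij_sd bij_block_comp)
qed

lemma cyc_del_gam: "cyc sr sd (n + d) (3 * n + 2 * d) = cyc sr sd (n + d) (n + 2 * d)"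
proof -
  have "cyc sr sd (n + d) (3 * n + 2 * d) = cyc sr (sr \<circ> (sr \<circ> sd)) (n + d) n"
    using cyc_sr_add2[of "n + d" n] by (simp add: algebra_simps)
  also have "\<dots> = cyc (sr \<circ> (sr \<circ> sd) \<circ> sr) (sr \<circ> (sr \<circ> sd)) d n"
    by (rule cyc_add') simp_all
  \<comment> \<open>Each pair is a three-cycle and a transposition moving its fixed letter; all such
    pairs on four letters are conjugate.\<close>
  also have "\<dots> = cyc (sr \<circ> sd) (sr \<circ> sd \<circ> sr) d n"
    by (rule cyc_block_conj[where \<pi> = "\<lambda>(i, j). (i \<noteq> j, j)"]) (auto simp: inj_def)
  also have "\<dots> = cyc (sr \<circ> sd \<circ> sr) (sr \<circ> sd) n d"
    by (rule cyc_swap) simp_all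
  finally show ?thesis by (simp add: cyc_gam[OF refl refl])
qed

lemma cyc_lam_gam: "cyc sr sd (n + d) (3 * n + 4 * d) = cyc sr sd n (n + d)"
proof -
  let ?y = "sr \<circ> (sr \<circ> (sr \<circ> sd))"
  have "cyc sr sd (n + d) (3 * n + 4 * d) = cyc sr (sr \<circ> (sr \<circ> sd)) (n + d) ((n + d) + d)"
    using cyc_sr_add2[of "n + d" "n + d + d"] by (simp add: algebra_simps)
  also have "\<dots> = cyc sr ?y (d + n) d"
    using cyc_add[of sr "sr \<circ> (sr \<circ> sd)" "n + d" d] by (simp add: add.commute)
  also have "\<dots> = cyc (?y \<circ> sr) ?y n d"
    by (rule cyc_add') simp_all
  \<comment> \<open>In both pairs the first permutation is a four-cycle and the second a
    three-cycle; \<pi> matches them.\<close>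
  also have "\<dots> = cyc sr (sr \<circ> sd) n d"
    by (rule cyc_block_conj[where \<pi> = "\<lambda>(i, j). (j, i \<noteq> j)"]) (auto simp: inj_def)
  also have "\<dots> = cyc sr sd n (n + d)"
    by (simp add: cyc_add)
  finally show ?thesis .
qed

text \<open>Since \<open>sr\<close> has order 4, the summand \<open>4 * m\<close> drops out; the
  reflection and the block transposition then exchange the lengths.\<close>

lemma cyc_lam_del: "cyc sr sd m (n + 4 * m) = cyc sr sd n m"
  using cyc_sr_add4[of m n] cyc_swap[of sr sd m n] cyc_sr_sd_swap[of n m] by simp

lemma cyc_gam_del: "cyc sr sd (2 * m + n) (3 * m + 2 * n) = cyc sr sd n (m + 2 * n)"
proof -
  have "cyc sr sd (2 * m + n) (3 * m + 2 * n) = cyc (sr \<circ> sd \<circ> sr) (sr \<circ> sd) m (m + n)"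
    by (rule cyc_gam) simp_all
  also have "\<dots> = cyc (sr \<circ> sd \<circ> sr) (sr \<circ> sd \<circ> sr \<circ> (sr \<circ> sd)) m n"
    by (rule cyc_add) simp_all
  \<comment> \<open>Each pair is a four-cycle and a transposition of two letters consecutive in
    it.\<close>
  also have "\<dots> = cyc (sr \<circ> (sr \<circ> sd)) sr m n"
    by (rule cyc_block_conj[where \<pi> = "\<lambda>(i, j). (i \<noteq> j, j)"]) (auto simp: inj_def)
  also have "\<dots> = cyc sr sd n (m + 2 * n)"
    by (simp add: cyc_swap[of _ sr] cyc_sr_add2)
  finally show ?thesis .
qed

lemma cyc_gam_lam: "cyc sr sd (3 * n + d) (5 * n + 2 * d) = cyc sr sd (n + d) (n + 2 * d)"
proof -
  let ?x = "sr \<circ> sd \<circ> sr" and ?y = "sr \<circ> sd"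
  have "cyc sr sd (3 * n + d) (5 * n + 2 * d) = cyc ?x ?y n (n + (n + d))"
    by (rule cyc_gam) simp_all
  also have "\<dots> = cyc ?x (?x \<circ> (?x \<circ> ?y)) n d"
    by (simp add: cyc_add)
  \<comment> \<open>\<open>?x\<close> is a transposition, so its two copies cancel.\<close>
  also have "?x \<circ> (?x \<circ> ?y) = ?y"
    by (auto simp: fun_eq_iff)
  finally show ?thesis unfolding cyc_gam[OF refl refl] .
qed

text \<open>\<open>gam\<close> adds the difference \<open>d\<close> to both entries, so this is
  \<open>cyc_gam\<close> with \<open>n + d\<close> for \<open>n\<close>, followed by one more
  Euclidean step.\<close>

lemma cyc_gam_gam:
  assumes "a = n + 2 * d" "b = n + 3 * d"
  shows "cyc sr sd a b = cyc (sr \<circ> sd \<circ> (sr \<circ> sd \<circ> sr)) (sr \<circ> sd) n d"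
proof -
  have "cyc sr sd a b = cyc (sr \<circ> sd \<circ> sr) (sr \<circ> sd) (d + n) d"
    by (rule cyc_gam) (simp_all add: assms)
  also have "\<dots> = cyc (sr \<circ> sd \<circ> (sr \<circ> sd \<circ> sr)) (sr \<circ> sd) n d"
    by (rule cyc_add') simp_all
  finally show ?thesis .
qed

lemma cyc_gam_gam_gam: "cyc sr sd (n + 3 * d) (n + 4 * d) = cyc sr sd n (n + d)"
proof -
  let ?y = "sr \<circ> sd"
  have "cyc sr sd (n + 3 * d) (n + 4 * d) = cyc (?y \<circ> (?y \<circ> sr)) ?y (d + n) d"
    unfolding comp_assoc[symmetric] by (rule cyc_gam_gam[unfolded comp_assoc[symmetric]]) simp_all
  also have "\<dots> = cyc (?y \<circ> (?y \<circ> (?y \<circ> sr))) ?y n d"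
    by (rule cyc_add') simp_all
  \<comment> \<open>Each \<open>gam\<close> contributes one factor \<open>?y\<close>, and
    \<open>?y\<close> is a three-cycle.\<close>
  also have "?y \<circ> (?y \<circ> (?y \<circ> sr)) = sr"
    by (auto simp: fun_eq_iff)
  also have "cyc sr ?y n d = cyc sr sd n (n + d)"
    by (simp add: cyc_add)
  finally show ?thesis .
qed

text \<open>The images of \<open>(m, n)\<close> under \<open>del\<close> and \<open>lam\<close> both
  have difference \<open>m + n\<close>, so one reduction serves both: \<open>k\<close> is the
  smaller entry of the image and \<open>l\<close> the other of \<open>m\<close> and
  \<open>n\<close>. The resulting four-cycles are conjugate to \<open>sd\<close>, \<open>sr\<close>
  in either order.\<close>

lemma cyc_gam_gam_add:
  "cyc sr sd (3 * k + 2 * l) (4 * k + 3 * l) =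
    cyc (sr \<circ> sd \<circ> (sr \<circ> sd \<circ> sr)) (sr \<circ> sd \<circ> (sr \<circ> sd \<circ> sr) \<circ> (sr \<circ> sd)) k l"
proof -
  have "cyc sr sd (3 * k + 2 * l) (4 * k + 3 * l) =
      cyc (sr \<circ> sd \<circ> (sr \<circ> sd \<circ> sr)) (sr \<circ> sd) k (k + l)"
    by (rule cyc_gam_gam) simp_all
  also have "\<dots> =
      cyc (sr \<circ> sd \<circ> (sr \<circ> sd \<circ> sr)) (sr \<circ> sd \<circ> (sr \<circ> sd \<circ> sr) \<circ> (sr \<circ> sd)) k l"
    by (rule cyc_add) simp_all
  finally show ?thesis .
qed

lemma cyc_gam_gam_del: "cyc sr sd (3 * m + 2 * n) (4 * m + 3 * n) = cyc sr sd n m"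
proof -
  have "cyc sr sd (3 * m + 2 * n) (4 * m + 3 * n) = cyc sd sr m n"
    unfolding cyc_gam_gam_add
    by (rule cyc_block_conj[where \<pi> = "\<lambda>(i, j). (i, i \<noteq> j)"]) (auto simp: inj_def)
  then show ?thesis by (simp add: cyc_swap[of sd])
qed

lemma cyc_gam_gam_lam: "cyc sr sd (3 * n + 2 * m) (4 * n + 3 * m) = cyc sr sd n m"
  unfolding cyc_gam_gam_add
  by (rule cyc_block_conj[where \<pi> = "\<lambda>(i, j). (i \<noteq> j, i)"]) (auto simp: inj_def)

theorem proposition11:
  fixes p :: "nat \<times> nat"
  assumes "even_odd_pair p"
  shows "del p \<approx>d gam p
    \<and> (\<forall>\<kappa> \<in> {gam, del, lam}. lam (\<kappa> p) \<approx>d p)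
    \<and> gam (del p) \<approx>d lam p
    \<and> gam (lam p) \<approx>d gam p
    \<and> (\<forall>\<kappa> \<in> {gam, del, lam}. gam (gam (\<kappa> p)) \<approx>d p)"
proof -
  obtain m n where p: "p = (m, n)" by fastforce
  then have "0 < n" "n < m" using assms by (auto simp: even_odd_pair_def)
  then obtain d where m: "m = n + d" "0 < d" using less_imp_add_positive by blast
  note defs = p diag_equiv_def gam_def del_def lam_def diag_eq_cyc \<open>0 < n\<close>
  \<comment> \<open>These evaluate the truncated subtractions produced by
    \<open>gam\<close>.\<close>
  have lengths: "2 * (n + d) - n = n + 2 * d" "2 * (n + 2 * d) - (n + d) = n + 3 * d"
    "2 * (n + 3 * d) - (n + 2 * d) = n + 4 * d"
    "2 * (2 * m + n) - m = 3 * m + 2 * n" "2 * (3 * m + 2 * n) - (2 * m + n) = 4 * m + 3 * n"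
    "2 * (m + 2 * n) - n = 3 * n + 2 * m" "2 * (3 * n + 2 * m) - (m + 2 * n) = 4 * n + 3 * m"
    by simp_all
  have "del p \<approx>d gam p"
    using cyc_del_gam[of n d] lengths(1) by (simp add: defs m algebra_simps)
  moreover have "lam (gam p) \<approx>d p"
    using cyc_lam_gam[of n d] lengths(1) by (simp add: defs m algebra_simps)
  moreover have "lam (del p) \<approx>d p"
    using cyc_lam_del[of m n] \<open>n < m\<close> by (simp add: defs algebra_simps)
  moreover have "lam (lam p) \<approx>d p"
    using cyc_sr_add4[of n m] \<open>n < m\<close> by (simp add: defs algebra_simps)
  moreover have "gam (del p) \<approx>d lam p"
    using cyc_gam_del[of m n] lengths(4) \<open>n < m\<close> by (simp add: defs algebra_simps)
  moreover have "gam (lam p) \<approx>d gam p"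
    using cyc_gam_lam[of n d] lengths(1,6) by (simp add: defs m algebra_simps)
  moreover have "gam (gam (gam p)) \<approx>d p"
    using cyc_gam_gam_gam[of n d] lengths(1-3) by (simp add: defs m add.commute)
  moreover have "gam (gam (del p)) \<approx>d p"
    using cyc_gam_gam_del[of m n] lengths(4,5) \<open>n < m\<close> by (simp add: defs add.commute)
  moreover have "gam (gam (lam p)) \<approx>d p"
    using cyc_gam_gam_lam[of n m] lengths(6,7) \<open>n < m\<close> by (simp add: defs add.commute)
  ultimately show ?thesis by simp
qed

end
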